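(* Let $\mathcal{G}=\langle A,\mathsf{act},\sim,\lambda\rangle$ be a game with imperfect information over a finite move alphabet $\Gamma$ with color alphabet $C=\{0,1\}$ and reachability objective $\mathsf{Reach}=0^*1\{0,1\}^\omega$, such that $\lambda(\tau)=1$ implies $\lambda(\tau c)=1$ for all $\tau\in\Gamma^*$ and $c\in\Gamma$. Let $h:\Gamma^*\to P$ be a rectangular morphism for $\mathcal{G}$ with $P$ finite. Let $$Y_*=\nu Y.\,\mu X.\ \mathrm{int}_{\approx}(Y)\cap(\mathsf{Pre}(X)\cup P_F)\ \subseteq\ P\cup(P\times A).$$ Then the abstract states in $Y_*$ are exactly the existentially winning states, which coincide with the universally winning states: $$Y_*\cap P=P_\forall=P_\exists.$$
   Context: **Games.** $\Gamma$ is a finite set of moves, $A$ a finite nonempty set of actions, $\mathsf{act}:\Gamma\to A$ is surjective. In each of infinitely many rounds the player chooses an action $a\in A$, then the environment chooses a move $c\in\Gamma$ with $\mathsf{act}(c)=a$. A history is an element of $\Gamma^*$, a play an element of $\Gamma^\omega$. The relation $\sim$ on $\Gamma^*$ is an indistinguishability relation: an equivalence such that (i) $\tau\sim\tau'$ implies $|\tau|=|\tau'|$; (ii) $\tau c\sim\tau'c'$ (with $c,c'\in\Gamma$) implies $\tau\sim\tau'$ and $\mathsf{act}(c)=\mathsf{act}(c')$. $[\tau]_\sim$ is the equivalence class (information set) of $\tau$. The coloring function $\lambda:\Gamma^*\to C$ ($C$ finite) is regular (computed by a finite-state Moore machine reading the history) and information consistent: $\tau\sim\tau'$ implies $\lambda(\tau)=\lambda(\tau')$.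 For a play $\pi=c_1c_2\dots$, $\hat\lambda(\pi)=\lambda(c_1)\lambda(c_1c_2)\cdots\in C^\omega$. **Strategies.** $\mathcal{D}(S)$ denotes the probability distributions on $S$. A player strategy is $\alpha:\Gamma^*\to\mathcal{D}(A)$ with $\alpha(\tau)=\alpha(\tau')$ whenever $\tau\sim\tau'$. An environment strategy is $\beta:\Gamma^*\times A\to\mathcal{D}(\Gamma)$ such that $\beta(\tau,a)(c)>0$ implies $\mathsf{act}(c)=a$. For $\tau\in\Gamma^*$, $\Pr_\tau^{\alpha,\beta}$ is the probability measure on $\Gamma^\omega$ giving the cylinder $\rho\Gamma^\omega$ measure $1$ if $\rho$ is a prefix of $\tau$; measure $\prod_{i=1}^k\alpha(\tau c_1\dots c_{i-1})(\mathsf{act}(c_i))\cdot\beta(\tau c_1\dots c_{i-1},\mathsf{act}(c_i))(c_i)$ if $\rho=\tau c_1\dots c_k$, $k\ge1$; and $0$ otherwise. For $L\subseteq C^\omega$, $\Pr_\tau^{\alpha,\beta}(L)$ means $\Pr_\tau^{\alpha,\beta}(\{\pi:\hat\lambda(\pi)\in L\})$. A player strategy $\alpha$ is almost-sure winning from $[\tau]_\sim$ for $L$ if $\Pr_{\tau'}^{\alpha,\beta}(L)=1$ for all $\tau'\in[\tau]_\sim$ and all environment strategies $\beta$. Here $L=\mathsf{Reach}$. **Rectangular morphism.** A surjective function $h:\Gamma^*\to P$ ($P$ finite; elements are called abstract states) such that for all $\tau,\tau'\in\Gamma^*$ with $h(\tau)=h(\tau')$ and all $c\in\Gamma$: $h([\tau]_\sim)=h([\tau']_\sim)$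 (images of sets), $h(\tau c)=h(\tau'c)$, and $\lambda(\tau)=\lambda(\tau')$. **Abstract notions.** $\approx\ =\{(h(\tau),h(\tau')):\tau\sim\tau'\}$ on $P$ (it is known to be an equivalence relation, with $h([\tau]_\sim)=[h(\tau)]_\approx$), extended to $P\times A$ by $(p,a)\approx(p',a')$ iff $p\approx p'$ and $a=a'$. For $Y\subseteq P\cup(P\times A)$, $\mathrm{int}_\approx(Y)$ is the set of elements whose whole $\approx$-class is contained in $Y$. $\delta^P:P\times\Gamma\to P$ is the function with $\delta^P(h(\tau),c)=h(\tau c)$. $P_F=\{p\in P:\exists\tau\in\Gamma^*,\ h(\tau)=p\wedge\lambda(\tau)=1\}$. For $X\subseteq P\cup(P\times A)$, $$\mathsf{Pre}(X)=\{p\in P:\exists a\in A,\ (p,a)\in X\}\cup\{(p,a)\in P\times A:\forall c\in\Gamma,\ \mathsf{act}(c)=a\Rightarrow\delta^P(p,c)\in X\}.$$ $\nu$ and $\mu$ denote greatest and least fixpoints of monotone operators on subsets of $P\cup(P\times A)$. **Winning abstract states.** $p\in P$ is existentially winning ($p\in P_\exists$) if there exists $\tau\in\Gamma^*$ with $h(\tau)=p$ such that the player has an almost-sure winning strategy from $[\tau]_\sim$; $p$ is universally winning ($p\in P_\forall$) if for all $\tau\in\Gamma^*$ with $h(\tau)=p$ the player has an almost-sure winning strategy from $[\tau]_\sim$. *)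

theory Defs
  imports "HOL-Probability.Probability" "HOL-Library.Sublist"
begin

section \<open>Games with imperfect information\<close>

text \<open>
  Moves and actions are the elements of types \<^typ>\<open>'c\<close> and \<^typ>\<open>'a\<close> of class \<^class>\<open>finite\<close>;
  histories are lists of moves and plays are streams of moves.
\<close>

definition indistinguishability :: "('c \<Rightarrow> 'a) \<Rightarrow> ('c list \<times> 'c list) set \<Rightarrow> bool" where
  "indistinguishability act sim \<longleftrightarrow>
     equiv UNIV sim \<and>
     (\<forall>\<tau> \<tau>'. (\<tau>, \<tau>') \<in> sim \<longrightarrow> length \<tau> = length \<tau>') \<and>
     (\<forall>\<tau> \<tau>' c c'. (\<tau> @ [c], \<tau>' @ [c']) \<in> sim \<longrightarrow> (\<tau>, \<tau>') \<in> sim \<and> act c = act c')"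

text \<open>
  A Moore machine with a finite set \<open>Q\<close> of states; since \<open>Q\<close> is finite, taking the states to be
  natural numbers is no restriction.
\<close>

definition regular_coloring :: "('c list \<Rightarrow> 'k) \<Rightarrow> bool" where
  "regular_coloring lam \<longleftrightarrow>
     (\<exists>(Q :: nat set) q0 step out.
        finite Q \<and> q0 \<in> Q \<and> (\<forall>q\<in>Q. \<forall>c. step q c \<in> Q) \<and>
        (\<forall>\<tau>. lam \<tau> = out (foldl step q0 \<tau>)))"

definition information_consistent :: "('c list \<times> 'c list) set \<Rightarrow> ('c list \<Rightarrow> 'k) \<Rightarrow> bool" where
  "information_consistent sim lam \<longleftrightarrow> (\<forall>\<tau> \<tau>'. (\<tau>, \<tau>') \<in> sim \<longrightarrow> lam \<tau> = lam \<tau>')"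

definition imperfect_information_game ::
  "('c::finite \<Rightarrow> 'a::finite) \<Rightarrow> ('c list \<times> 'c list) set \<Rightarrow> 'k set \<Rightarrow> ('c list \<Rightarrow> 'k) \<Rightarrow> bool" where
  "imperfect_information_game act sim C lam \<longleftrightarrow>
     surj act \<and> indistinguishability act sim \<and>
     finite C \<and> (\<forall>\<tau>. lam \<tau> \<in> C) \<and> regular_coloring lam \<and> information_consistent sim lam"

text \<open>The color sequence of \<open>c\<^sub>1 c\<^sub>2 \<dots>\<close> is \<open>\<lambda>(c\<^sub>1) \<lambda>(c\<^sub>1 c\<^sub>2) \<dots>\<close>; the empty history does not contribute.\<close>

definition color_sequence :: "('c list \<Rightarrow> 'k) \<Rightarrow> 'c stream \<Rightarrow> 'k stream" where
  "color_sequence lam \<pi> = smap (\<lambda>n. lam (stake n \<pi>)) (fromN 1)"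

definition Reach :: "nat stream set" where
  "Reach = {replicate n 0 @- (1 ## w) | n w. w \<in> streams {0, 1}}"


section \<open>Strategies and the induced probability measure\<close>

definition player_strategy :: "('c list \<times> 'c list) set \<Rightarrow> ('c list \<Rightarrow> 'a pmf) \<Rightarrow> bool" where
  "player_strategy sim \<alpha> \<longleftrightarrow> (\<forall>\<tau> \<tau>'. (\<tau>, \<tau>') \<in> sim \<longrightarrow> \<alpha> \<tau> = \<alpha> \<tau>')"

definition environment_strategy :: "('c \<Rightarrow> 'a) \<Rightarrow> ('c list \<Rightarrow> 'a \<Rightarrow> 'c pmf) \<Rightarrow> bool" where
  "environment_strategy act \<beta> \<longleftrightarrow> (\<forall>\<tau> a c. pmf (\<beta> \<tau> a) c > 0 \<longrightarrow> act c = a)"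

definition cylinder_prob ::
  "('c \<Rightarrow> 'a) \<Rightarrow> ('c list \<Rightarrow> 'a pmf) \<Rightarrow> ('c list \<Rightarrow> 'a \<Rightarrow> 'c pmf) \<Rightarrow> 'c list \<Rightarrow> 'c list \<Rightarrow> real" where
  "cylinder_prob act \<alpha> \<beta> \<tau> \<rho> =
     (if prefix \<rho> \<tau> then 1
      else if prefix \<tau> \<rho> then
        (\<Prod>i\<in>{length \<tau>..<length \<rho>}.
           pmf (\<alpha> (take i \<rho>)) (act (\<rho> ! i)) * pmf (\<beta> (take i \<rho>) (act (\<rho> ! i))) (\<rho> ! i))
      else 0)"

text \<open>
  The cylinder of plays extending \<open>\<rho>\<close> is \<^term>\<open>sstart UNIV \<rho>\<close>. The measure is characterised by its
  values on cylinders; existence and uniqueness are shown below.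
\<close>

definition is_play_measure ::
  "('c \<Rightarrow> 'a) \<Rightarrow> ('c list \<Rightarrow> 'a pmf) \<Rightarrow> ('c list \<Rightarrow> 'a \<Rightarrow> 'c pmf) \<Rightarrow> 'c list \<Rightarrow> 'c stream measure \<Rightarrow> bool"
  where
  "is_play_measure act \<alpha> \<beta> \<tau> M \<longleftrightarrow>
     prob_space M \<and> sets M = sets (stream_space (count_space UNIV)) \<and>
     (\<forall>\<rho>. measure M (sstart UNIV \<rho>) = cylinder_prob act \<alpha> \<beta> \<tau> \<rho>)"

definition play_measure ::
  "('c \<Rightarrow> 'a) \<Rightarrow> ('c list \<Rightarrow> 'a pmf) \<Rightarrow> ('c list \<Rightarrow> 'a \<Rightarrow> 'c pmf) \<Rightarrow> 'c list \<Rightarrow> 'c stream measure"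
  where
  "play_measure act \<alpha> \<beta> \<tau> = (THE M. is_play_measure act \<alpha> \<beta> \<tau> M)"

definition almost_sure_winning ::
  "('c \<Rightarrow> 'a) \<Rightarrow> ('c list \<times> 'c list) set \<Rightarrow> ('c list \<Rightarrow> 'k) \<Rightarrow> 'k stream set \<Rightarrow>
   ('c list \<Rightarrow> 'a pmf) \<Rightarrow> 'c list \<Rightarrow> bool" where
  "almost_sure_winning act sim lam L \<alpha> \<tau> \<longleftrightarrow>
     (\<forall>\<tau>'\<in>sim `` {\<tau>}. \<forall>\<beta>. environment_strategy act \<beta> \<longrightarrow>
        measure (play_measure act \<alpha> \<beta> \<tau>') {\<pi>. color_sequence lam \<pi> \<in> L} = 1)"

definition has_almost_sure_winning_strategy ::
  "('c \<Rightarrow> 'a) \<Rightarrow> ('c list \<times> 'c list) set \<Rightarrow> ('c list \<Rightarrow> 'k) \<Rightarrow> 'k stream set \<Rightarrow> 'c list \<Rightarrow> bool"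
  where
  "has_almost_sure_winning_strategy act sim lam L \<tau> \<longleftrightarrow>
     (\<exists>\<alpha>. player_strategy sim \<alpha> \<and> almost_sure_winning act sim lam L \<alpha> \<tau>)"


section \<open>Rectangular morphisms and abstract states\<close>

definition rectangular_morphism ::
  "('c list \<times> 'c list) set \<Rightarrow> ('c list \<Rightarrow> 'k) \<Rightarrow> ('c list \<Rightarrow> 'p) \<Rightarrow> bool" where
  "rectangular_morphism sim lam h \<longleftrightarrow>
     surj h \<and>
     (\<forall>\<tau> \<tau>' c. h \<tau> = h \<tau>' \<longrightarrow>
        h ` (sim `` {\<tau>}) = h ` (sim `` {\<tau>'}) \<and>
        h (\<tau> @ [c]) = h (\<tau>' @ [c]) \<and>
        lam \<tau> = lam \<tau>')"

text \<open>\<open>P \<union> (P \<times> A)\<close> is the sum type \<^typ>\<open>'p + 'p \<times> 'a\<close>.\<close>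

definition abs_equiv :: "('c list \<times> 'c list) set \<Rightarrow> ('c list \<Rightarrow> 'p) \<Rightarrow> ('p \<times> 'p) set" where
  "abs_equiv sim h = {(h \<tau>, h \<tau>') | \<tau> \<tau>'. (\<tau>, \<tau>') \<in> sim}"

definition abs_equiv_ext ::
  "('c list \<times> 'c list) set \<Rightarrow> ('c list \<Rightarrow> 'p) \<Rightarrow> (('p + 'p \<times> 'a) \<times> ('p + 'p \<times> 'a)) set" where
  "abs_equiv_ext sim h =
     {(Inl p, Inl p') | p p'. (p, p') \<in> abs_equiv sim h} \<union>
     {(Inr (p, a), Inr (p', a)) | p p' a. (p, p') \<in> abs_equiv sim h}"

definition int_approx ::
  "('c list \<times> 'c list) set \<Rightarrow> ('c list \<Rightarrow> 'p) \<Rightarrow> ('p + 'p \<times> 'a) set \<Rightarrow> ('p + 'p \<times> 'a) set" where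
  "int_approx sim h Y = {y. abs_equiv_ext sim h `` {y} \<subseteq> Y}"

definition abs_step :: "('c list \<Rightarrow> 'p) \<Rightarrow> 'p \<Rightarrow> 'c \<Rightarrow> 'p" where
  "abs_step h = (THE d. \<forall>\<tau> c. d (h \<tau>) c = h (\<tau> @ [c]))"

definition abs_final :: "('c list \<Rightarrow> nat) \<Rightarrow> ('c list \<Rightarrow> 'p) \<Rightarrow> 'p set" where
  "abs_final lam h = {p. \<exists>\<tau>. h \<tau> = p \<and> lam \<tau> = 1}"

definition Pre ::
  "('c \<Rightarrow> 'a) \<Rightarrow> ('c list \<Rightarrow> 'p) \<Rightarrow> ('p + 'p \<times> 'a) set \<Rightarrow> ('p + 'p \<times> 'a) set" where
  "Pre act h X =
     {Inl p | p. \<exists>a. Inr (p, a) \<in> X} \<union>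
     {Inr (p, a) | p a. \<forall>c. act c = a \<longrightarrow> Inl (abs_step h p c) \<in> X}"

definition Y_star ::
  "('c \<Rightarrow> 'a) \<Rightarrow> ('c list \<times> 'c list) set \<Rightarrow> ('c list \<Rightarrow> nat) \<Rightarrow> ('c list \<Rightarrow> 'p) \<Rightarrow> ('p + 'p \<times> 'a) set"
  where
  "Y_star act sim lam h =
     gfp (\<lambda>Y. lfp (\<lambda>X. int_approx sim h Y \<inter> (Pre act h X \<union> Inl ` abs_final lam h)))"

definition existentially_winning ::
  "('c \<Rightarrow> 'a) \<Rightarrow> ('c list \<times> 'c list) set \<Rightarrow> ('c list \<Rightarrow> nat) \<Rightarrow> ('c list \<Rightarrow> 'p) \<Rightarrow> 'p set" where
  "existentially_winning act sim lam h =
     {p. \<exists>\<tau>. h \<tau> = p \<and> has_almost_sure_winning_strategy act sim lam Reach \<tau>}"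

definition universally_winning ::
  "('c \<Rightarrow> 'a) \<Rightarrow> ('c list \<times> 'c list) set \<Rightarrow> ('c list \<Rightarrow> nat) \<Rightarrow> ('c list \<Rightarrow> 'p) \<Rightarrow> 'p set" where
  "universally_winning act sim lam h =
     {p. \<forall>\<tau>. h \<tau> = p \<longrightarrow> has_almost_sure_winning_strategy act sim lam Reach \<tau>}"


section \<open>Well-definedness\<close>

lemma sstart_UNIV_eq: "sstart UNIV \<rho> = range ((@-) \<rho>)"
  by (induction \<rho>) (auto simp: sstart.simps(2))

lemma abs_step_eq:
  assumes "rectangular_morphism sim lam h"
  shows "abs_step h (h \<tau>) c = h (\<tau> @ [c])"
proof -
  have surj: "surj h" using assms by (simp add: rectangular_morphism_def)
  have step: "h (\<tau> @ [c]) = h (\<tau>' @ [c])" if "h \<tau> = h \<tau>'" for \<tau> \<tau>' c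
    using assms[unfolded rectangular_morphism_def, THEN conjunct2, rule_format, OF that, of c] by blast
  have "\<exists>!d. \<forall>\<tau> c. d (h \<tau>) c = h (\<tau> @ [c])"
  proof (rule ex1I[of _ "\<lambda>p c. h (inv h p @ [c])"])
    show "\<forall>\<tau> c. h (inv h (h \<tau>) @ [c]) = h (\<tau> @ [c])"
      by (intro allI step f_inv_into_f rangeI)
  next
    fix d assume d: "\<forall>\<tau> c. d (h \<tau>) c = h (\<tau> @ [c])"
    show "d = (\<lambda>p c. h (inv h p @ [c]))"
    proof (intro ext)
      fix p c show "d p c = h (inv h p @ [c])"
        using d[rule_format, of "inv h p" c] by (simp only: surj_f_inv_f[OF surj])
    qed
  qed
  from theI'[OF this] show ?thesis unfolding abs_step_def by blast
qed

lemma Pre_mono: "X \<subseteq> X' \<Longrightarrow> Pre act h X \<subseteq> Pre act h X'"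
  unfolding Pre_def by blast

lemma int_approx_mono: "Y \<subseteq> Y' \<Longrightarrow> int_approx sim h Y \<subseteq> int_approx sim h Y'"
  unfolding int_approx_def by blast

lemma mono_inner: "mono (\<lambda>X. int_approx sim h Y \<inter> (Pre act h X \<union> F))"
  by (intro monoI Int_mono Un_mono Pre_mono order_refl)

lemma mono_outer: "mono (\<lambda>Y. lfp (\<lambda>X. int_approx sim h Y \<inter> (Pre act h X \<union> F)))"
  by (intro monoI lfp_mono Int_mono int_approx_mono order_refl)

lemma is_play_measure_unique:
  fixes act :: "'c::countable \<Rightarrow> 'a"
  assumes "is_play_measure act \<alpha> \<beta> \<tau> M" "is_play_measure act \<alpha> \<beta> \<tau> N"
  shows "M = N"
proof -
  interpret M: prob_space M using assms(1) by (simp add: is_play_measure_def)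
  interpret N: prob_space N using assms(2) by (simp add: is_play_measure_def)
  show ?thesis
  proof (rule stream_space_eq_sstart[of UNIV])
    show "emeasure M (sstart UNIV xs) = emeasure N (sstart UNIV xs)" for xs
      using assms by (simp add: is_play_measure_def M.emeasure_eq_measure N.emeasure_eq_measure)
  qed (use assms in \<open>auto simp: is_play_measure_def\<close>)
qed

text \<open>
  For existence, sample a next move independently for every history and follow the samples.
\<close>

primrec sampled_history :: "('c list \<Rightarrow> 'c) \<Rightarrow> nat \<Rightarrow> 'c list" where
  "sampled_history f 0 = []"
| "sampled_history f (Suc n) = sampled_history f n @ [f (sampled_history f n)]"

lemma length_sampled_history [simp]: "length (sampled_history f n) = n"
  by (induction n) auto

lemma stake_sampled: "stake n (to_stream (\<lambda>n. f (sampled_history f n))) = sampled_history f n"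
  by (induction n) (simp_all add: stake_Suc to_stream_def del: stake.simps(2))

lemma sampled_history_eq_iff:
  "sampled_history f (length \<rho>) = \<rho> \<longleftrightarrow> (\<forall>i<length \<rho>. f (take i \<rho>) = \<rho> ! i)"
proof (induction \<rho> rule: rev_induct)
  case (snoc c \<rho>)
  have "(\<forall>i<length (\<rho> @ [c]). f (take i (\<rho> @ [c])) = (\<rho> @ [c]) ! i) \<longleftrightarrow>
        (\<forall>i<length \<rho>. f (take i \<rho>) = \<rho> ! i) \<and> f \<rho> = c"
    by (auto simp: less_Suc_eq nth_append)
  then show ?case using snoc.IH by auto
qed simp

lemma in_sstart_iff_stake: "\<pi> \<in> sstart UNIV \<rho> \<longleftrightarrow> stake (length \<rho>) \<pi> = \<rho>"
  by (simp add: sstart_eq list_eq_iff_nth_eq)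

lemma play_measure_kernel:
  fixes act :: "'c::countable \<Rightarrow> 'a"
    and \<alpha> :: "'c list \<Rightarrow> 'a pmf" and \<tau> :: "'c list"
  assumes env: "environment_strategy act \<beta>"
  defines "K \<equiv> \<lambda>\<sigma>. if length \<sigma> < length \<tau> then return_pmf (\<tau> ! length \<sigma>) else bind_pmf (\<alpha> \<sigma>) (\<beta> \<sigma>)"
  shows "(\<Prod>i<length \<rho>. pmf (K (take i \<rho>)) (\<rho> ! i)) = cylinder_prob act \<alpha> \<beta> \<tau> \<rho>"
proof -
  have bind: "pmf (bind_pmf (\<alpha> \<sigma>) (\<beta> \<sigma>)) c = pmf (\<alpha> \<sigma>) (act c) * pmf (\<beta> \<sigma> (act c)) c" for \<sigma> c
  proof -
    have "pmf (\<beta> \<sigma> a) c = pmf (\<beta> \<sigma> (act c)) c * indicator {act c} a" for a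
      using env pmf_nonneg[of "\<beta> \<sigma> a" c]
      by (cases "a = act c") (auto simp: environment_strategy_def order_less_le)
    then have "pmf (bind_pmf (\<alpha> \<sigma>) (\<beta> \<sigma>)) c =
        measure_pmf.expectation (\<alpha> \<sigma>) (\<lambda>a. pmf (\<beta> \<sigma> (act c)) c * indicator {act c} a)"
      by (subst pmf_bind) (metis (no_types, lifting))
    also have "\<dots> = pmf (\<alpha> \<sigma>) (act c) * pmf (\<beta> \<sigma> (act c)) c"
      by (simp add: measure_pmf_single)
    finally show ?thesis .
  qed
  consider "prefix \<rho> \<tau>" | "\<not> prefix \<rho> \<tau>" "prefix \<tau> \<rho>" | "\<not> prefix \<rho> \<tau>" "\<not> prefix \<tau> \<rho>" by blast
  then show ?thesis
  proof cases
    case 1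
    then obtain \<sigma> where \<sigma>: "\<tau> = \<rho> @ \<sigma>" by (auto simp: prefix_def)
    have "(\<Prod>i<length \<rho>. pmf (K (take i \<rho>)) (\<rho> ! i)) = 1"
      by (rule prod.neutral) (auto simp: K_def \<sigma> nth_append)
    then show ?thesis using 1 by (simp add: cylinder_prob_def)
  next
    case 2
    then obtain \<sigma> where \<sigma>: "\<rho> = \<tau> @ \<sigma>" by (auto simp: prefix_def)
    have split: "{..<length \<rho>} = {..<length \<tau>} \<union> {length \<tau>..<length \<rho>}" by (auto simp: \<sigma>)
    have "(\<Prod>i<length \<tau>. pmf (K (take i \<rho>)) (\<rho> ! i)) = 1"
      by (rule prod.neutral) (auto simp: K_def \<sigma> nth_append)
    moreover have "(\<Prod>i\<in>{length \<tau>..<length \<rho>}. pmf (K (take i \<rho>)) (\<rho> ! i)) = cylinder_prob act \<alpha> \<beta> \<tau> \<rho>"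
      using 2 by (auto simp: cylinder_prob_def K_def bind intro!: prod.cong)
    ultimately show ?thesis
      by (subst split, subst prod.union_disjoint) auto
  next
    case 3
    have "\<exists>i<length \<rho>. i < length \<tau> \<and> \<rho> ! i \<noteq> \<tau> ! i"
    proof (rule ccontr)
      assume "\<not> ?thesis"
      then have *: "\<And>i. i < length \<rho> \<Longrightarrow> i < length \<tau> \<Longrightarrow> \<rho> ! i = \<tau> ! i" by blast
      show False
      proof (cases "length \<rho> \<le> length \<tau>")
        case True
        then have "\<rho> = take (length \<rho>) \<tau>" using * by (intro nth_equalityI) auto
        with 3 show False by (metis take_is_prefix)
      next
        case False
        then have "\<tau> = take (length \<tau>) \<rho>" using * by (intro nth_equalityI) auto
        with 3 show False by (metis take_is_prefix)
      qed
    qed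
    then obtain i where i: "i < length \<rho>" "i < length \<tau>" "\<rho> ! i \<noteq> \<tau> ! i" by blast
    have "(\<Prod>i<length \<rho>. pmf (K (take i \<rho>)) (\<rho> ! i)) = 0"
      using i by (intro prod_zero bexI[of _ i]) (auto simp: K_def pmf_return)
    then show ?thesis using 3 by (simp add: cylinder_prob_def)
  qed
qed

lemma is_play_measure_exists:
  fixes act :: "'c::countable \<Rightarrow> 'a"
  assumes env: "environment_strategy act \<beta>"
  shows "\<exists>M. is_play_measure act \<alpha> \<beta> \<tau> M"
proof -
  define K where
    "K \<sigma> = (if length \<sigma> < length \<tau> then return_pmf (\<tau> ! length \<sigma>) else bind_pmf (\<alpha> \<sigma>) (\<beta> \<sigma>))" for \<sigma>
  define S where "S = (\<Pi>\<^sub>M \<sigma>\<in>UNIV. measure_pmf (K \<sigma>))"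
  define play where "play f = to_stream (\<lambda>n. f (sampled_history f n))" for f :: "'c list \<Rightarrow> 'c"
  interpret product_prob_space "\<lambda>\<sigma>. measure_pmf (K \<sigma>)" UNIV
    by unfold_locales
  have S: "prob_space S" unfolding S_def by (rule prob_space_PiM) unfold_locales
  have eval [measurable]: "(\<lambda>f. f \<sigma>) \<in> S \<rightarrow>\<^sub>M count_space UNIV" for \<sigma>
    unfolding S_def using measurable_component_singleton[of \<sigma> UNIV "\<lambda>\<sigma>. measure_pmf (K \<sigma>)"] by simp
  have hist [measurable]: "(\<lambda>f. sampled_history f n) \<in> S \<rightarrow>\<^sub>M count_space UNIV" for n
  proof (induction n)
    case (Suc n)
    note Suc [measurable]
    have [measurable]: "(\<lambda>f. f (sampled_history f n)) \<in> S \<rightarrow>\<^sub>M count_space UNIV"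
      by (rule measurable_compose_countable[OF _ Suc]) (rule eval)
    show ?case by simp
  qed simp
  have play [measurable]: "play \<in> S \<rightarrow>\<^sub>M stream_space (count_space UNIV)"
  proof (rule measurable_stream_space2)
    fix n
    have "(\<lambda>f. f (sampled_history f n)) \<in> S \<rightarrow>\<^sub>M count_space UNIV"
      by (rule measurable_compose_countable[OF _ hist]) (rule eval)
    then show "(\<lambda>f. play f !! n) \<in> S \<rightarrow>\<^sub>M count_space UNIV"
      by (simp add: play_def to_stream_def)
  qed
  define M where "M = distr S (stream_space (count_space UNIV)) play"
  have "measure M (sstart UNIV \<rho>) = cylinder_prob act \<alpha> \<beta> \<tau> \<rho>" for \<rho>
  proof -
    define J where "J = (\<lambda>i. take i \<rho>) ` {..<length \<rho>}"
    have inj: "inj_on (\<lambda>i. take i \<rho>) {..<length \<rho>}"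
      by (rule inj_onI) (metis length_take lessThan_iff min.absorb4)
    have "measure M (sstart UNIV \<rho>) = measure S (play -` sstart UNIV \<rho> \<inter> space S)"
      unfolding M_def by (rule measure_distr) auto
    also have "play -` sstart UNIV \<rho> \<inter> space S =
        prod_emb UNIV (\<lambda>\<sigma>. measure_pmf (K \<sigma>)) J (\<Pi>\<^sub>E \<sigma>\<in>J. {\<rho> ! length \<sigma>})"
      by (auto simp: in_sstart_iff_stake play_def stake_sampled sampled_history_eq_iff S_def
          space_PiM prod_emb_def J_def PiE_iff min_def)
    also have "measure S \<dots> = (\<Prod>\<sigma>\<in>J. measure (K \<sigma>) {\<rho> ! length \<sigma>})"
      unfolding S_def by (rule measure_PiM_emb) (auto simp: J_def)
    also have "\<dots> = (\<Prod>i<length \<rho>. pmf (K (take i \<rho>)) (\<rho> ! i))"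
      unfolding J_def by (subst prod.reindex[OF inj]) (simp add: measure_pmf_single min_def)
    also have "\<dots> = cylinder_prob act \<alpha> \<beta> \<tau> \<rho>"
      unfolding K_def by (rule play_measure_kernel[OF env])
    finally show ?thesis .
  qed
  moreover have "prob_space M"
    unfolding M_def by (rule prob_space.prob_space_distr[OF S play])
  ultimately have "is_play_measure act \<alpha> \<beta> \<tau> M"
    by (simp add: is_play_measure_def M_def)
  then show ?thesis ..
qed

lemma is_play_measure_play_measure:
  fixes act :: "'c::countable \<Rightarrow> 'a"
  assumes "environment_strategy act \<beta>"
  shows "is_play_measure act \<alpha> \<beta> \<tau> (play_measure act \<alpha> \<beta> \<tau>)"
proof -
  have "\<exists>!M. is_play_measure act \<alpha> \<beta> \<tau> M"
    using is_play_measure_exists[OF assms] by (auto intro: is_play_measure_unique)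
  then show ?thesis unfolding play_measure_def by (rule theI')
qed

end

theory Submission
  imports Defs
begin

text \<open>
  From \<open>Y\<^sub>*\<close> the player wins by choosing uniformly among the actions \<open>a\<close> for which \<open>(h \<tau>, a) \<in> Y\<^sub>*\<close>:
  this choice depends only on the information set and keeps the play in \<open>Y\<^sub>*\<close>, and the stages of the
  inner least fixpoint yield a uniform positive lower bound on the probability of reaching the target
  within a fixed number of rounds, so the target is missed forever with probability \<open>0\<close>.

  Conversely, let \<open>W\<close> consist of the abstractions of all histories consistent with some winning strategy,
  together with the actions that the strategy plays there with positive probability. \<open>W\<close> is closed under
  \<open>\<approx>\<close>, and it is a post-fixpoint: if some such history were outside the inner fixpoint for \<open>W\<close>, then the
  environment could steer the play there with positive probability and stay outside from then on.
\<close>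

section \<open>Cylinder probabilities and one-round probabilities\<close>

text \<open>For \<open>\<rho> = \<tau>\<close> the first branch of \<open>cylinder_prob\<close>
  gives 1, which is also the value of the empty product.\<close>

lemma cylinder_prob_extend:
  assumes "prefix \<tau> \<rho>"
  shows "cylinder_prob act \<alpha> \<beta> \<tau> \<rho> =
    (\<Prod>i\<in>{length \<tau>..<length \<rho>}.
       pmf (\<alpha> (take i \<rho>)) (act (\<rho> ! i)) * pmf (\<beta> (take i \<rho>) (act (\<rho> ! i))) (\<rho> ! i))"
  using assms prefix_order.order_antisym[of \<tau> \<rho>] by (auto simp: cylinder_prob_def)

lemma cylinder_prob_refl [simp]: "cylinder_prob act \<alpha> \<beta> \<tau> \<tau> = 1"
  by (simp add: cylinder_prob_def)

definition step_prob ::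
  "('c \<Rightarrow> 'a) \<Rightarrow> ('c list \<Rightarrow> 'a pmf) \<Rightarrow> ('c list \<Rightarrow> 'a \<Rightarrow> 'c pmf) \<Rightarrow> 'c list \<Rightarrow> 'c \<Rightarrow> real" where
  "step_prob act \<alpha> \<beta> \<sigma> c = pmf (\<alpha> \<sigma>) (act c) * pmf (\<beta> \<sigma> (act c)) c"

lemma step_prob_nonneg [simp]: "0 \<le> step_prob act \<alpha> \<beta> \<sigma> c"
  by (simp add: step_prob_def)

lemma cylinder_prob_snoc:
  assumes "prefix \<tau> \<rho>"
  shows "cylinder_prob act \<alpha> \<beta> \<tau> (\<rho> @ [c]) = cylinder_prob act \<alpha> \<beta> \<tau> \<rho> * step_prob act \<alpha> \<beta> \<rho> c"
proof -
  have "length \<tau> \<le> length \<rho>" using assms by (rule prefix_length_le)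
  moreover have "prefix \<tau> (\<rho> @ [c])" using assms by simp
  ultimately show ?thesis
    using assms by (simp add: cylinder_prob_extend step_prob_def nth_append)
qed

lemma sum_env_strategy:
  fixes act :: "'c::finite \<Rightarrow> 'a"
  assumes "environment_strategy act \<beta>"
  shows "(\<Sum>c | act c = a. pmf (\<beta> \<sigma> a) c) = 1"
  using assms by (intro sum_pmf_eq_1) (auto simp: environment_strategy_def set_pmf_iff less_le)

text \<open>A legal environment spreads its whole mass over the moves carrying the chosen action, so
  the sum does not depend on \<open>\<beta>\<close>.\<close>

lemma sum_step_prob_action:
  fixes act :: "'c::finite \<Rightarrow> 'a"
  assumes "environment_strategy act \<beta>"
  shows "(\<Sum>c | act c = a. step_prob act \<alpha> \<beta> \<sigma> c) = pmf (\<alpha> \<sigma>) a"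
proof -
  have "(\<Sum>c | act c = a. step_prob act \<alpha> \<beta> \<sigma> c) = (\<Sum>c | act c = a. pmf (\<alpha> \<sigma>) a * pmf (\<beta> \<sigma> a) c)"
    by (rule sum.cong) (auto simp: step_prob_def)
  also have "\<dots> = pmf (\<alpha> \<sigma>) a"
    using sum_env_strategy[OF assms] by (simp flip: sum_distrib_left)
  finally show ?thesis .
qed

lemma sum_step_prob:
  fixes act :: "'c::finite \<Rightarrow> 'a::finite"
  assumes "environment_strategy act \<beta>"
  shows "(\<Sum>c\<in>UNIV. step_prob act \<alpha> \<beta> \<sigma> c) = 1"
proof -
  have "(\<Sum>c\<in>UNIV. step_prob act \<alpha> \<beta> \<sigma> c) = (\<Sum>a\<in>UNIV. \<Sum>c | act c = a. step_prob act \<alpha> \<beta> \<sigma> c)"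
    using sum.group[of UNIV UNIV act "step_prob act \<alpha> \<beta> \<sigma>"] by simp
  also have "\<dots> = 1"
    by (simp add: sum_step_prob_action[OF assms] sum_pmf_eq_1)
  finally show ?thesis .
qed

section \<open>Probability of missing the target\<close>

text \<open>The probability that the history reached after \<open>k\<close> further rounds is not colored \<open>1\<close>.\<close>

primrec miss ::
  "('c::finite \<Rightarrow> 'a) \<Rightarrow> ('c list \<Rightarrow> nat) \<Rightarrow> ('c list \<Rightarrow> 'a pmf) \<Rightarrow> ('c list \<Rightarrow> 'a \<Rightarrow> 'c pmf) \<Rightarrow>
   nat \<Rightarrow> 'c list \<Rightarrow> real" where
  "miss act lam \<alpha> \<beta> 0 \<sigma> = (if lam \<sigma> = 1 then 0 else 1)"
| "miss act lam \<alpha> \<beta> (Suc k) \<sigma> = (\<Sum>c\<in>UNIV. step_prob act \<alpha> \<beta> \<sigma> c * miss act lam \<alpha> \<beta> k (\<sigma> @ [c]))"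

lemma miss_nonneg: "0 \<le> miss act lam \<alpha> \<beta> k \<sigma>"
  by (induction k arbitrary: \<sigma>) (auto intro!: sum_nonneg mult_nonneg_nonneg)

lemma stake_in_sets:
  fixes M :: "'c::finite stream measure"
  assumes "sets M = sets (stream_space (count_space UNIV))"
  shows "{\<pi>. Q (stake n \<pi>)} \<in> sets M"
proof -
  have "{\<pi>. Q (stake n \<pi>)} = (\<Union>\<rho>\<in>{\<rho>. length \<rho> = n \<and> Q \<rho>}. sstart UNIV \<rho>)"
    by (auto simp: in_sstart_iff_stake)
  also have "\<dots> \<in> sets M"
  proof (rule sets.countable_UN'')
    show "sstart UNIV \<rho> \<in> sets M" for \<rho> unfolding assms by (rule sstart_sets)
  qed simp
  finally show ?thesis .
qed

text \<open>Connects \<open>miss\<close> with the measure: the cylinder of \<open>\<rho>\<close>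
  splits into those of its one-move extensions. Allowing any extension \<open>\<rho>\<close> of
  \<open>\<tau>\<close> lets the induction hypothesis apply to \<open>\<rho> @ [c]\<close>.\<close>

lemma play_measure_miss:
  fixes act :: "'c::finite \<Rightarrow> 'a"
  assumes "is_play_measure act \<alpha> \<beta> \<tau> M" "prefix \<tau> \<rho>"
  shows "measure M (sstart UNIV \<rho> \<inter> {\<pi>. lam (stake (length \<rho> + k) \<pi>) \<noteq> 1}) =
    cylinder_prob act \<alpha> \<beta> \<tau> \<rho> * miss act lam \<alpha> \<beta> k \<rho>"
  using assms(2)
proof (induction k arbitrary: \<rho>)
  case 0
  have "sstart UNIV \<rho> \<inter> {\<pi>. lam (stake (length \<rho> + 0) \<pi>) \<noteq> 1} =
      (if lam \<rho> = 1 then {} else sstart UNIV \<rho>)"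
    by (auto simp: in_sstart_iff_stake)
  then show ?case using assms(1) by (simp add: is_play_measure_def)
next
  case (Suc k)
  interpret prob_space M using assms(1) by (simp add: is_play_measure_def)
  have sets: "sets M = sets (stream_space (count_space UNIV))"
    using assms(1) by (simp add: is_play_measure_def)
  define E where "E = {\<pi>. lam (stake (length \<rho> + Suc k) \<pi>) \<noteq> 1}"
  have E: "E \<in> sets M" unfolding E_def using stake_in_sets[OF sets, of "\<lambda>\<rho>. lam \<rho> \<noteq> 1"] .
  have "sstart UNIV \<rho> \<inter> E = (\<Union>c. sstart UNIV (\<rho> @ [c]) \<inter> E)"
    by (auto simp: in_sstart_iff_stake stake_Suc simp del: stake.simps(2))
  also have "measure M \<dots> = (\<Sum>c\<in>UNIV. measure M (sstart UNIV (\<rho> @ [c]) \<inter> E))"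
  proof (rule finite_measure_finite_Union)
    show "disjoint_family_on (\<lambda>c. sstart UNIV (\<rho> @ [c]) \<inter> E) UNIV"
      by (auto simp: disjoint_family_on_def in_sstart_iff_stake stake_Suc simp del: stake.simps(2))
    have "sstart UNIV (\<rho> @ [c]) \<inter> E \<in> sets M" for c
      unfolding sets using E[unfolded sets] by (rule sets.Int[OF sstart_sets])
    then show "(\<lambda>c. sstart UNIV (\<rho> @ [c]) \<inter> E) ` UNIV \<subseteq> sets M" by blast
  qed simp
  also have "\<dots> = (\<Sum>c\<in>UNIV. cylinder_prob act \<alpha> \<beta> \<tau> \<rho> * (step_prob act \<alpha> \<beta> \<rho> c * miss act lam \<alpha> \<beta> k (\<rho> @ [c])))"
  proof (rule sum.cong[OF refl])
    fix c
    have "prefix \<tau> (\<rho> @ [c])" using Suc.prems by simp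
    from Suc.IH[OF this] cylinder_prob_snoc[OF Suc.prems, of act \<alpha> \<beta> c]
    show "measure M (sstart UNIV (\<rho> @ [c]) \<inter> E) =
        cylinder_prob act \<alpha> \<beta> \<tau> \<rho> * (step_prob act \<alpha> \<beta> \<rho> c * miss act lam \<alpha> \<beta> k (\<rho> @ [c]))"
      by (simp add: E_def)
  qed
  finally show ?case by (simp add: E_def sum_distrib_left)
qed

section \<open>The reachability objective in terms of finite prefixes\<close>

text \<open>Index 0 is excluded because the empty history contributes no color. Conversely, only
  zeros precede the first 1, as no other colors occur.\<close>

lemma color_sequence_in_Reach_iff:
  assumes "\<And>\<tau>. lam \<tau> \<in> {0, 1}"
  shows "color_sequence lam \<pi> \<in> Reach \<longleftrightarrow> (\<exists>n>0. lam (stake n \<pi>) = 1)"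
proof
  have nth: "color_sequence lam \<pi> !! n = lam (stake (Suc n) \<pi>)" for n
    by (simp add: color_sequence_def del: stake.simps(2))
  show "\<exists>n>0. lam (stake n \<pi>) = 1" if "color_sequence lam \<pi> \<in> Reach"
  proof -
    from that obtain n w where "color_sequence lam \<pi> = replicate n 0 @- (1 ## w)"
      by (auto simp: Reach_def)
    then have "color_sequence lam \<pi> !! n = 1" by simp
    then show ?thesis unfolding nth by blast
  qed
  assume "\<exists>n>0. lam (stake n \<pi>) = 1"
  then have ex: "\<exists>n. color_sequence lam \<pi> !! n = 1" unfolding nth by (metis Suc_pred)
  define m where "m = (LEAST n. color_sequence lam \<pi> !! n = 1)"
  have m: "color_sequence lam \<pi> !! m = 1" unfolding m_def using ex by (rule LeastI_ex)
  have "color_sequence lam \<pi> !! n = 0" if "n < m" for n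
    using not_less_Least[of n, folded m_def] that assms[of "stake (Suc n) \<pi>"]
    by (auto simp: m_def nth simp del: stake.simps(2))
  then have "stake m (color_sequence lam \<pi>) = replicate m 0"
    by (intro nth_equalityI) auto
  moreover have "sdrop m (color_sequence lam \<pi>) = 1 ## sdrop (Suc m) (color_sequence lam \<pi>)"
    using stream.collapse[of "sdrop m (color_sequence lam \<pi>)"] m by simp
  ultimately have eq: "color_sequence lam \<pi> = replicate m 0 @- (1 ## sdrop (Suc m) (color_sequence lam \<pi>))"
    using stake_sdrop[of m "color_sequence lam \<pi>"] by simp
  have "sset (sdrop (Suc m) (color_sequence lam \<pi>)) \<subseteq> sset (color_sequence lam \<pi>)"
    by (auto simp: sset_range sdrop_snth simp del: sdrop.simps snth.simps)
  also have "\<dots> \<subseteq> {0, 1}"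
    unfolding color_sequence_def stream.set_map by (rule image_subsetI) (rule assms)
  finally have "sdrop (Suc m) (color_sequence lam \<pi>) \<in> streams {0, 1}"
    by (simp add: streams_iff_sset)
  then show "color_sequence lam \<pi> \<in> Reach"
    unfolding Reach_def using eq by blast
qed

section \<open>Basic facts about the game and its rectangular morphism\<close>

locale reachability_game =
  fixes act :: "'c::finite \<Rightarrow> 'a::finite"
    and sim :: "('c list \<times> 'c list) set"
    and lam :: "'c list \<Rightarrow> nat"
    and h :: "'c list \<Rightarrow> 'p::finite"
  assumes game: "imperfect_information_game act sim {0, 1} lam"
    and absorbing: "lam \<tau> = 1 \<Longrightarrow> lam (\<tau> @ [c]) = 1"
    and morphism: "rectangular_morphism sim lam h"
begin

lemma surj_act: "surj act"
  using game unfolding imperfect_information_game_def by (rule conjunct1)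

lemma sim_indist: "indistinguishability act sim"
  using game unfolding imperfect_information_game_def by (elim conjE)

lemma sim_equiv: "equiv UNIV sim"
  using sim_indist unfolding indistinguishability_def by (rule conjunct1)

lemma sim_refl: "(\<tau>, \<tau>) \<in> sim"
  using equiv_class_self[OF sim_equiv] by simp

lemma sim_sym: "(\<tau>, \<tau>') \<in> sim \<Longrightarrow> (\<tau>', \<tau>) \<in> sim"
  using sim_equiv by (meson equivE symD)

lemma sim_trans: "(\<tau>, \<tau>') \<in> sim \<Longrightarrow> (\<tau>', \<tau>'') \<in> sim \<Longrightarrow> (\<tau>, \<tau>'') \<in> sim"
  using sim_equiv by (meson equivE transD)

lemma sim_length: "(\<tau>, \<tau>') \<in> sim \<Longrightarrow> length \<tau> = length \<tau>'"
  using sim_indist unfolding indistinguishability_def by blast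

lemma sim_snocD:
  "(\<tau> @ [c], \<tau>' @ [c']) \<in> sim \<Longrightarrow> (\<tau>, \<tau>') \<in> sim \<and> act c = act c'"
  using sim_indist unfolding indistinguishability_def by blast

lemma lam_range: "lam \<tau> \<in> {0, 1}"
  using game unfolding imperfect_information_game_def by blast

lemma h_class_eq: "h \<tau> = h \<tau>' \<Longrightarrow> h ` (sim `` {\<tau>}) = h ` (sim `` {\<tau>'})"
  using morphism unfolding rectangular_morphism_def by blast

lemma lam_eq: "h \<tau> = h \<tau>' \<Longrightarrow> lam \<tau> = lam \<tau>'"
  using morphism unfolding rectangular_morphism_def by blast

lemma surj_h: "surj h"
  using morphism unfolding rectangular_morphism_def by blast

lemmas step_h = abs_step_eq[OF morphism]

lemma abs_final_iff: "h \<tau> \<in> abs_final lam h \<longleftrightarrow> lam \<tau> = 1"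
  by (auto simp: abs_final_def dest: lam_eq)

text \<open>\<open>abs_equiv\<close> only provides some pair of indistinguishable representatives;
  equality of the images of information sets moves it to the given \<open>\<tau>\<close>.\<close>

lemma abs_equiv_lift:
  assumes "(h \<tau>, p') \<in> abs_equiv sim h"
  obtains \<tau>' where "(\<tau>, \<tau>') \<in> sim" "h \<tau>' = p'"
proof -
  obtain \<sigma> \<sigma>' where "h \<sigma> = h \<tau>" "h \<sigma>' = p'" "(\<sigma>, \<sigma>') \<in> sim"
    using assms by (auto simp: abs_equiv_def)
  then have "p' \<in> h ` (sim `` {\<tau>})" using h_class_eq[of \<sigma> \<tau>] by blast
  then show ?thesis using that by blast
qed

lemma int_approx_subset: "int_approx sim h Y \<subseteq> Y"
proof
  fix y assume y: "y \<in> int_approx sim h Y"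
  have "(p, p) \<in> abs_equiv sim h" for p
    using surj_h sim_refl by (auto simp: abs_equiv_def) (metis surj_f_inv_f)
  then have "(y, y) \<in> abs_equiv_ext sim h"
    by (cases y) (auto simp: abs_equiv_ext_def)
  then show "y \<in> Y" using y by (auto simp: int_approx_def)
qed

lemma absorbing_append: "lam \<tau> = 1 \<Longrightarrow> lam (\<tau> @ \<rho>) = 1"
proof (induction \<rho> rule: rev_induct)
  case (snoc c \<rho>)
  then show ?case using absorbing[of "\<tau> @ \<rho>" c] by simp
qed simp

lemma absorbing_stake: "lam (stake n \<pi>) = 1 \<Longrightarrow> n \<le> m \<Longrightarrow> lam (stake m \<pi>) = 1"
  using absorbing_append[of "stake n \<pi>" "stake (m - n) (sdrop n \<pi>)"]
  by (simp add: stake_add[symmetric, of n "m - n"])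

text \<open>Absorption makes \<open>n = 0\<close> harmless: if the empty history is colored 1, so is
  every history of length 1.\<close>

lemma in_Reach_iff: "color_sequence lam \<pi> \<in> Reach \<longleftrightarrow> (\<exists>n. lam (stake n \<pi>) = 1)"
proof -
  have "\<exists>n>0. lam (stake n \<pi>) = 1" if "lam (stake n \<pi>) = 1" for n
    using absorbing_stake[OF that, of "Suc n"] by (intro exI[of _ "Suc n"]) simp
  then show ?thesis
    unfolding color_sequence_in_Reach_iff[of lam, OF lam_range] by blast
qed

lemma Reach_in_sets:
  assumes "sets M = sets (stream_space (count_space UNIV))"
  shows "{\<pi>. color_sequence lam \<pi> \<in> Reach} \<in> sets M"
proof -
  have "{\<pi>. color_sequence lam \<pi> \<in> Reach} = (\<Union>n. {\<pi>. lam (stake n \<pi>) = 1})"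
    by (auto simp: in_Reach_iff)
  also have "\<dots> \<in> sets M"
    using stake_in_sets[OF assms, of "\<lambda>\<rho>. lam \<rho> = 1"] by (intro sets.countable_UN) auto
  finally show ?thesis .
qed

section \<open>Geometric decay of the missing probability\<close>

lemma miss_final: "lam \<sigma> = 1 \<Longrightarrow> miss act lam \<alpha> \<beta> k \<sigma> = 0"
proof (induction k arbitrary: \<sigma>)
  case (Suc k)
  then show ?case using absorbing[OF Suc.prems] by simp
qed simp

context
  fixes \<beta> assumes env: "environment_strategy act \<beta>"
begin

lemma miss_le_1: "miss act lam \<alpha> \<beta> k \<sigma> \<le> 1"
proof (induction k arbitrary: \<sigma>)
  case (Suc k)
  have "miss act lam \<alpha> \<beta> (Suc k) \<sigma> \<le> (\<Sum>c\<in>UNIV. step_prob act \<alpha> \<beta> \<sigma> c)"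
    unfolding miss.simps by (intro sum_mono mult_right_le_one_le Suc miss_nonneg step_prob_nonneg)
  then show ?case by (simp only: sum_step_prob[OF env])
qed simp

lemma miss_Suc_le: "miss act lam \<alpha> \<beta> (Suc k) \<sigma> \<le> miss act lam \<alpha> \<beta> k \<sigma>"
proof (induction k arbitrary: \<sigma>)
  case 0
  then show ?case
    using miss_final[of \<sigma> \<alpha> \<beta> "Suc 0"] miss_le_1[of \<alpha> "Suc 0" \<sigma>]
    by (auto simp del: miss.simps(2))
next
  case (Suc k)
  have "(\<Sum>c\<in>UNIV. step_prob act \<alpha> \<beta> \<sigma> c * miss act lam \<alpha> \<beta> (Suc k) (\<sigma> @ [c])) \<le>
      (\<Sum>c\<in>UNIV. step_prob act \<alpha> \<beta> \<sigma> c * miss act lam \<alpha> \<beta> k (\<sigma> @ [c]))"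
    by (intro sum_mono mult_left_mono Suc step_prob_nonneg)
  then show ?case by (simp only: miss.simps(2))
qed

lemma miss_antimono: "k \<le> l \<Longrightarrow> miss act lam \<alpha> \<beta> l \<sigma> \<le> miss act lam \<alpha> \<beta> k \<sigma>"
  by (rule lift_Suc_antimono_le[of "\<lambda>k. miss act lam \<alpha> \<beta> k \<sigma>", OF miss_Suc_le])

text \<open>A Markov-type estimate: a play that has not reached the target by round \<open>j\<close>
  is still in \<open>G\<close>, so it misses during the next \<open>k\<close> rounds with
  probability at most \<open>d\<close>. Histories colored 1 contribute 0 on both sides.\<close>

lemma miss_mult:
  assumes inv: "\<And>\<sigma> c. G \<sigma> \<Longrightarrow> lam \<sigma> \<noteq> 1 \<Longrightarrow> step_prob act \<alpha> \<beta> \<sigma> c > 0 \<Longrightarrow> G (\<sigma> @ [c])"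
    and bound: "\<And>\<sigma>. G \<sigma> \<Longrightarrow> miss act lam \<alpha> \<beta> k \<sigma> \<le> d"
    and "G \<sigma>"
  shows "miss act lam \<alpha> \<beta> (j + k) \<sigma> \<le> d * miss act lam \<alpha> \<beta> j \<sigma>"
  using \<open>G \<sigma>\<close>
proof (induction j arbitrary: \<sigma>)
  case 0
  then show ?case using bound miss_final by auto
next
  case (Suc j)
  show ?case
  proof (cases "lam \<sigma> = 1")
    case False
    have "step_prob act \<alpha> \<beta> \<sigma> c * miss act lam \<alpha> \<beta> (j + k) (\<sigma> @ [c]) \<le>
        d * (step_prob act \<alpha> \<beta> \<sigma> c * miss act lam \<alpha> \<beta> j (\<sigma> @ [c]))" for c
    proof (cases "step_prob act \<alpha> \<beta> \<sigma> c = 0")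
      case False
      then have "step_prob act \<alpha> \<beta> \<sigma> c > 0" using step_prob_nonneg[of act \<alpha> \<beta> \<sigma> c] by linarith
      from Suc.IH[OF inv[OF Suc.prems \<open>lam \<sigma> \<noteq> 1\<close> this]] show ?thesis
        by (metis mult.left_commute mult_left_mono step_prob_nonneg)
    qed simp
    then show ?thesis by (auto simp: sum_distrib_left intro!: sum_mono)
  qed (simp add: miss_final del: miss.simps)
qed

lemma miss_power:
  assumes inv: "\<And>\<sigma> c. G \<sigma> \<Longrightarrow> lam \<sigma> \<noteq> 1 \<Longrightarrow> step_prob act \<alpha> \<beta> \<sigma> c > 0 \<Longrightarrow> G (\<sigma> @ [c])"
    and bound: "\<And>\<sigma>. G \<sigma> \<Longrightarrow> miss act lam \<alpha> \<beta> k \<sigma> \<le> d"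
    and "0 \<le> d" and "G \<sigma>"
  shows "miss act lam \<alpha> \<beta> (m * k) \<sigma> \<le> d ^ m"
proof (induction m)
  case 0
  then show ?case by simp
next
  case (Suc m)
  have "miss act lam \<alpha> \<beta> (m * k + k) \<sigma> \<le> d * miss act lam \<alpha> \<beta> (m * k) \<sigma>"
    by (rule miss_mult[where G = G, OF inv bound \<open>G \<sigma>\<close>])
  also have "\<dots> \<le> d * d ^ m" using Suc \<open>0 \<le> d\<close> by (rule mult_left_mono)
  finally show ?case by (simp add: add.commute)
qed

text \<open>Missing forever implies missing after \<open>m * k\<close> rounds for every
  \<open>m\<close>, an event of probability at most \<open>d ^ m\<close>, which tends to 0.\<close>

lemma reach_almost_surely:
  assumes inv: "\<And>\<sigma> c. G \<sigma> \<Longrightarrow> lam \<sigma> \<noteq> 1 \<Longrightarrow> step_prob act \<alpha> \<beta> \<sigma> c > 0 \<Longrightarrow> G (\<sigma> @ [c])"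
    and bound: "\<And>\<sigma>. G \<sigma> \<Longrightarrow> miss act lam \<alpha> \<beta> k \<sigma> \<le> d"
    and d: "0 \<le> d" "d < 1" and "G \<tau>"
  shows "measure (play_measure act \<alpha> \<beta> \<tau>) {\<pi>. color_sequence lam \<pi> \<in> Reach} = 1"
proof -
  define M where "M = play_measure act \<alpha> \<beta> \<tau>"
  define R where "R = {\<pi>. color_sequence lam \<pi> \<in> Reach}"
  have pm: "is_play_measure act \<alpha> \<beta> \<tau> M"
    unfolding M_def by (rule is_play_measure_play_measure[OF env])
  interpret prob_space M using pm by (simp add: is_play_measure_def)
  have sets: "sets M = sets (stream_space (count_space UNIV))"
    using pm by (simp add: is_play_measure_def)
  have space: "space M = UNIV"
    using sets_eq_imp_space_eq[OF sets] by (simp add: space_stream_space)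
  have R: "R \<in> sets M" unfolding R_def by (rule Reach_in_sets[OF sets])
  have "prob (- R) \<le> d ^ m" for m
  proof -
    let ?E = "{\<pi>. lam (stake (length \<tau> + m * k) \<pi>) \<noteq> 1}"
    have E: "?E \<in> sets M" using stake_in_sets[OF sets, of "\<lambda>\<rho>. lam \<rho> \<noteq> 1"] .
    have C: "sstart UNIV \<tau> \<in> sets M" using sets by auto
    have "prob (sstart UNIV \<tau>) = 1" using pm by (simp add: is_play_measure_def)
    \<comment> \<open>Plays extend \<open>\<tau>\<close> almost surely, so intersecting with this
      cylinder gives the shape of \<open>play_measure_miss\<close> without changing the
      probability.\<close>
    then have "AE \<pi> in M. \<pi> \<in> sstart UNIV \<tau>" using prob_eq_1[OF C] by simp
    then have "prob ?E = prob (sstart UNIV \<tau> \<inter> ?E)"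
      by (intro finite_measure_eq_AE E sets.Int[OF C E]) auto
    moreover have "prob (- R) \<le> prob ?E"
      using E by (intro finite_measure_mono) (auto simp: R_def in_Reach_iff)
    ultimately have "prob (- R) \<le> miss act lam \<alpha> \<beta> (m * k) \<tau>"
      using play_measure_miss[OF pm, of \<tau> lam "m * k"] by simp
    also have "\<dots> \<le> d ^ m"
      by (rule miss_power[where G = G, OF inv bound d(1) \<open>G \<tau>\<close>])
    finally show ?thesis .
  qed
  then have "prob (- R) \<le> 0"
    using d by (intro LIMSEQ_le_const[OF LIMSEQ_realpow_zero]) auto
  then have "prob (space M - R) = 0"
    by (simp add: space Compl_eq_Diff_UNIV measure_le_0_iff)
  then show ?thesis
    using prob_compl[OF R] by (simp add: M_def R_def)
qed

end

section \<open>Fixpoint equations and closure properties of \<open>Y_star\<close>\<close>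

text \<open>As a least fixpoint relative to itself, \<open>Y_star\<close> admits the induction that
  later bounds the number of rounds to the target.\<close>

lemma Y_star_lfp:
  "Y_star act sim lam h =
    lfp (\<lambda>X. int_approx sim h (Y_star act sim lam h) \<inter> (Pre act h X \<union> Inl ` abs_final lam h))"
  unfolding Y_star_def by (rule gfp_unfold[OF mono_outer])

lemma Y_star_unfold:
  "Y_star act sim lam h =
    int_approx sim h (Y_star act sim lam h) \<inter> (Pre act h (Y_star act sim lam h) \<union> Inl ` abs_final lam h)"
  by (rule lfp_unfold[OF mono_inner[of sim h "Y_star act sim lam h" act "Inl ` abs_final lam h"],
        folded Y_star_lfp])

lemma Y_star_int: "Y_star act sim lam h \<subseteq> int_approx sim h (Y_star act sim lam h)"
  using Y_star_unfold by blast

lemma Inl_Y_starD: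
  assumes "Inl (h \<sigma>) \<in> Y_star act sim lam h" "lam \<sigma> \<noteq> 1"
  shows "\<exists>a. Inr (h \<sigma>, a) \<in> Y_star act sim lam h"
proof -
  have "Inl (h \<sigma>) \<in> Pre act h (Y_star act sim lam h) \<union> Inl ` abs_final lam h"
    using assms(1) Y_star_unfold by blast
  then show ?thesis using assms(2) abs_final_iff[of \<sigma>] by (auto simp: Pre_def)
qed

lemma Inr_Y_starD:
  assumes "Inr (h \<sigma>, act c) \<in> Y_star act sim lam h"
  shows "Inl (h (\<sigma> @ [c])) \<in> Y_star act sim lam h"
proof -
  have "Inr (h \<sigma>, act c) \<in> Pre act h (Y_star act sim lam h)"
    using assms Y_star_unfold by blast
  then show ?thesis by (auto simp: Pre_def step_h)
qed

lemma abs_equiv_ext_sim: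
  assumes "(\<sigma>, \<sigma>') \<in> sim"
  shows "(Inl (h \<sigma>), Inl (h \<sigma>')) \<in> abs_equiv_ext sim h"
    and "(Inr (h \<sigma>, a), Inr (h \<sigma>', a)) \<in> abs_equiv_ext sim h"
  using assms unfolding abs_equiv_ext_def abs_equiv_def by blast+

lemma Y_star_equiv:
  "(y, y') \<in> abs_equiv_ext sim h \<Longrightarrow> y \<in> Y_star act sim lam h \<Longrightarrow> y' \<in> Y_star act sim lam h"
  using Y_star_int unfolding int_approx_def by blast

lemmas Y_star_sim = abs_equiv_ext_sim[THEN Y_star_equiv]

lemma one_le_card_UNIV: "1 \<le> real (card (UNIV :: 'a set))"
  using finite_UNIV_card_ge_0[where 'a = 'a] by simp

section \<open>The strategy choosing uniformly among safe actions\<close>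

definition safe_actions :: "'c list \<Rightarrow> 'a set" where
  "safe_actions \<sigma> = {a. Inr (h \<sigma>, a) \<in> Y_star act sim lam h}"

text \<open>When no action is safe, the choice is irrelevant, but it must depend only on the information set.\<close>

definition safe_strategy :: "'c list \<Rightarrow> 'a pmf" where
  "safe_strategy \<sigma> = pmf_of_set (if safe_actions \<sigma> = {} then UNIV else safe_actions \<sigma>)"

text \<open>\<open>Y_star\<close> is a union of equivalence classes, so indistinguishable histories
  have the same safe actions.\<close>

lemma player_strategy_safe: "player_strategy sim safe_strategy"
proof -
  have "safe_actions \<sigma> = safe_actions \<sigma>'" if "(\<sigma>, \<sigma>') \<in> sim" for \<sigma> \<sigma>'
    using Y_star_sim(2)[OF that] Y_star_sim(2)[OF sim_sym[OF that]] by (auto simp: safe_actions_def)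
  then show ?thesis by (simp add: player_strategy_def safe_strategy_def)
qed

lemma pmf_safe_strategy_ge:
  assumes "a \<in> safe_actions \<sigma>"
  shows "1 / card (UNIV :: 'a set) \<le> pmf (safe_strategy \<sigma>) a"
proof -
  have "card (safe_actions \<sigma>) \<le> card (UNIV :: 'a set)" by (intro card_mono) auto
  moreover have "card (safe_actions \<sigma>) > 0" using assms by (subst card_gt_0_iff) auto
  ultimately have "1 / card (UNIV :: 'a set) \<le> 1 / card (safe_actions \<sigma>)"
    by (intro frac_le) simp_all
  also have "\<dots> = pmf (safe_strategy \<sigma>) a"
    using assms by (auto simp: safe_strategy_def pmf_of_set)
  finally show ?thesis .
qed

text \<open>A state of \<open>Y_star\<close> not colored 1 has a safe action, so the default
  \<open>UNIV\<close> does not occur and every move of positive probability carries a safe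
  action.\<close>

lemma safe_strategy_invariant:
  assumes "Inl (h \<sigma>) \<in> Y_star act sim lam h" "lam \<sigma> \<noteq> 1"
    and "step_prob act safe_strategy \<beta> \<sigma> c > 0"
  shows "Inl (h (\<sigma> @ [c])) \<in> Y_star act sim lam h"
proof -
  have "safe_actions \<sigma> \<noteq> {}" using Inl_Y_starD[OF assms(1,2)] by (simp add: safe_actions_def)
  moreover have "pmf (safe_strategy \<sigma>) (act c) \<noteq> 0" using assms(3) by (auto simp: step_prob_def)
  ultimately have "act c \<in> safe_actions \<sigma>" by (auto simp: safe_strategy_def indicator_def split: if_splits)
  then show ?thesis by (intro Inr_Y_starD) (simp add: safe_actions_def)
qed

text \<open>The action \<open>a\<close> is played with probability at least one over the number of
  actions, and every answer to it leaves a chance of at least \<open>e\<close>; moves of other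
  actions get the trivial bound 1.\<close>

lemma miss_safe_step:
  assumes env: "environment_strategy act \<beta>"
    and a: "a \<in> safe_actions \<sigma>" and "0 \<le> e"
    and le: "\<And>c. act c = a \<Longrightarrow> miss act lam safe_strategy \<beta> k (\<sigma> @ [c]) \<le> 1 - e"
  shows "miss act lam safe_strategy \<beta> (Suc k) \<sigma> \<le> 1 - (1 / card (UNIV :: 'a set)) * e"
proof -
  let ?s = "step_prob act safe_strategy \<beta> \<sigma>"
  have "miss act lam safe_strategy \<beta> (Suc k) \<sigma> \<le> (\<Sum>c\<in>UNIV. ?s c - (if act c = a then ?s c * e else 0))"
    unfolding miss.simps
  proof (rule sum_mono)
    fix c
    have "?s c * miss act lam safe_strategy \<beta> k (\<sigma> @ [c]) \<le> ?s c * (if act c = a then 1 - e else 1)"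
      using le miss_le_1[OF env] by (intro mult_left_mono) auto
    then show "?s c * miss act lam safe_strategy \<beta> k (\<sigma> @ [c]) \<le> ?s c - (if act c = a then ?s c * e else 0)"
      by (auto simp: algebra_simps split: if_splits)
  qed
  also have "\<dots> = 1 - (\<Sum>c | act c = a. ?s c * e)"
    by (simp add: sum_subtractf sum_step_prob[OF env] sum.If_cases)
  also have "\<dots> = 1 - pmf (safe_strategy \<sigma>) a * e"
    by (simp add: sum_step_prob_action[OF env] flip: sum_distrib_right)
  also have "\<dots> \<le> 1 - (1 / card (UNIV :: 'a set)) * e"
    using mult_right_mono[OF pmf_safe_strategy_ge[OF a] \<open>0 \<le> e\<close>] by simp
  finally show ?thesis .
qed

text \<open>Induction over the inner fixpoint: its stages bound the number of rounds to the target.\<close>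

lemma miss_safe_state:
  assumes env: "environment_strategy act \<beta>"
    and "Inl p \<in> Y_star act sim lam h"
  shows "\<exists>k. \<forall>\<sigma>. h \<sigma> = p \<longrightarrow> miss act lam safe_strategy \<beta> k \<sigma> \<le> 1 - (1 / card (UNIV :: 'a set)) ^ k"
proof -
  define e where "e = 1 / real (card (UNIV :: 'a set))"
  have e: "0 \<le> e" "e \<le> 1" using one_le_card_UNIV unfolding e_def by simp_all
  let ?Y = "Y_star act sim lam h" and ?m = "miss act lam safe_strategy \<beta>"
  \<comment> \<open>The exponent counts rounds, each costing a factor \<open>e\<close>. Action
    elements also record membership in \<open>Y_star\<close>, so that \<open>a\<close> is safe when
    \<open>miss_safe_step\<close> is applied.\<close>
  define T where "T = {Inl p | p. \<exists>k. \<forall>\<sigma>. h \<sigma> = p \<longrightarrow> ?m k \<sigma> \<le> 1 - e ^ k} \<union>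
    {Inr (p, a) | p a. Inr (p, a) \<in> ?Y \<and> (\<exists>k. \<forall>\<sigma> c. h \<sigma> = p \<longrightarrow> act c = a \<longrightarrow> ?m k (\<sigma> @ [c]) \<le> 1 - e ^ k)}"
  have "int_approx sim h ?Y \<inter> (Pre act h T \<union> Inl ` abs_final lam h) \<subseteq> T"
  proof
    fix x assume x: "x \<in> int_approx sim h ?Y \<inter> (Pre act h T \<union> Inl ` abs_final lam h)"
    then have "x \<in> ?Y" using int_approx_subset by blast
    consider (final) p where "x = Inl p" "p \<in> abs_final lam h"
      | (state) p a where "x = Inl p" "Inr (p, a) \<in> T"
      | (action) p a where "x = Inr (p, a)" "\<And>c. act c = a \<Longrightarrow> Inl (abs_step h p c) \<in> T"
      using x by (auto simp: Pre_def)
    then show "x \<in> T"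
    proof cases
      case final
      then have "\<forall>\<sigma>. h \<sigma> = p \<longrightarrow> ?m 0 \<sigma> \<le> 1 - e ^ 0" using abs_final_iff by auto
      then show ?thesis using final unfolding T_def by blast
    next
      case state
      then obtain k where Y: "Inr (p, a) \<in> ?Y"
        and k: "\<And>\<sigma> c. h \<sigma> = p \<Longrightarrow> act c = a \<Longrightarrow> ?m k (\<sigma> @ [c]) \<le> 1 - e ^ k"
        by (auto simp: T_def)
      have "?m (Suc k) \<sigma> \<le> 1 - e ^ Suc k" if "h \<sigma> = p" for \<sigma>
        using miss_safe_step[OF env, of a \<sigma> "e ^ k" k] Y k that e
        by (simp add: safe_actions_def e_def del: miss.simps)
      then show ?thesis using state unfolding T_def by blast
    next
      case action
      have "\<exists>k. \<forall>\<sigma>. h \<sigma> = p \<longrightarrow> act c = a \<longrightarrow> ?m k (\<sigma> @ [c]) \<le> 1 - e ^ k" for c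
      proof (cases "act c = a")
        case True
        then obtain k where "\<forall>\<sigma>. h \<sigma> = abs_step h p c \<longrightarrow> ?m k \<sigma> \<le> 1 - e ^ k"
          using action(2) by (auto simp: T_def)
        then have "\<forall>\<sigma>. h \<sigma> = p \<longrightarrow> act c = a \<longrightarrow> ?m k (\<sigma> @ [c]) \<le> 1 - e ^ k"
          by (auto simp: step_h simp del: miss.simps)
        then show ?thesis ..
      qed simp
      then obtain K where K: "\<And>c \<sigma>. h \<sigma> = p \<Longrightarrow> act c = a \<Longrightarrow> ?m (K c) (\<sigma> @ [c]) \<le> 1 - e ^ K c"
        using choice[of "\<lambda>c k. \<forall>\<sigma>. h \<sigma> = p \<longrightarrow> act c = a \<longrightarrow> ?m k (\<sigma> @ [c]) \<le> 1 - e ^ k"] by blast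
      \<comment> \<open>There are finitely many moves, so one number of rounds serves all: as
        \<open>k\<close> grows, \<open>?m k\<close> does not increase and \<open>1 - e ^ k\<close>
        does not decrease.\<close>
      have "?m (Max (range K)) (\<sigma> @ [c]) \<le> 1 - e ^ Max (range K)" if "h \<sigma> = p" "act c = a" for \<sigma> c
      proof -
        have "K c \<le> Max (range K)" by simp
        from miss_antimono[OF env this, of safe_strategy "\<sigma> @ [c]"] power_decreasing[OF this e] K[OF that]
        show ?thesis by linarith
      qed
      then show ?thesis using action(1) \<open>x \<in> ?Y\<close> unfolding T_def by blast
    qed
  qed
  then have "?Y \<subseteq> T" by (subst Y_star_lfp) (rule lfp_lowerbound)
  then show ?thesis using assms(2) by (auto simp: T_def e_def)
qed

text \<open>A maximum over the finitely many abstract states. The bound may depend on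
  \<open>\<beta>\<close>, which suffices since \<open>reach_almost_surely\<close> treats one
  environment at a time.\<close>

lemma miss_safe_uniform:
  assumes env: "environment_strategy act \<beta>"
  shows "\<exists>k d. 0 \<le> d \<and> d < 1 \<and>
    (\<forall>\<sigma>. Inl (h \<sigma>) \<in> Y_star act sim lam h \<longrightarrow> miss act lam safe_strategy \<beta> k \<sigma> \<le> d)"
proof -
  define e where "e = 1 / real (card (UNIV :: 'a set))"
  have e: "0 < e" "e \<le> 1" using one_le_card_UNIV unfolding e_def by simp_all
  obtain K where K: "\<And>\<sigma>. Inl (h \<sigma>) \<in> Y_star act sim lam h \<Longrightarrow>
      miss act lam safe_strategy \<beta> (K (h \<sigma>)) \<sigma> \<le> 1 - e ^ K (h \<sigma>)"
  proof -
    have "\<forall>p. \<exists>k. Inl p \<in> Y_star act sim lam h \<longrightarrow>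
        (\<forall>\<sigma>. h \<sigma> = p \<longrightarrow> miss act lam safe_strategy \<beta> k \<sigma> \<le> 1 - e ^ k)"
      using miss_safe_state[OF env] unfolding e_def by blast
    from choice[OF this] show ?thesis using that by blast
  qed
  let ?k = "Max (range K)"
  have "miss act lam safe_strategy \<beta> ?k \<sigma> \<le> 1 - e ^ ?k" if "Inl (h \<sigma>) \<in> Y_star act sim lam h" for \<sigma>
  proof -
    have "K (h \<sigma>) \<le> ?k" by simp
    from miss_antimono[OF env this, of safe_strategy \<sigma>] power_decreasing[OF this less_imp_le[OF e(1)] e(2)] K[OF that]
    show ?thesis by linarith
  qed
  moreover have "0 \<le> 1 - e ^ ?k" "1 - e ^ ?k < 1" using e by (auto simp: power_le_one)
  ultimately show ?thesis by (intro exI conjI allI impI)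
qed

lemma Y_star_winning:
  assumes "Inl (h \<tau>) \<in> Y_star act sim lam h"
  shows "has_almost_sure_winning_strategy act sim lam Reach \<tau>"
  unfolding has_almost_sure_winning_strategy_def almost_sure_winning_def
proof (intro exI conjI ballI allI impI)
  show "player_strategy sim safe_strategy" by (rule player_strategy_safe)
  fix \<tau>' \<beta> assume "\<tau>' \<in> sim `` {\<tau>}" and env: "environment_strategy act \<beta>"
  then have \<tau>': "Inl (h \<tau>') \<in> Y_star act sim lam h" using Y_star_sim(1) assms by blast
  obtain k d where d: "0 \<le> d" "d < 1"
    and miss: "\<And>\<sigma>. Inl (h \<sigma>) \<in> Y_star act sim lam h \<Longrightarrow> miss act lam safe_strategy \<beta> k \<sigma> \<le> d"
    using miss_safe_uniform[OF env] by blast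
  show "measure (play_measure act safe_strategy \<beta> \<tau>') {\<pi>. color_sequence lam \<pi> \<in> Reach} = 1"
  proof (rule reach_almost_surely[OF env, where G = "\<lambda>\<sigma>. Inl (h \<sigma>) \<in> Y_star act sim lam h"])
    show "Inl (h (\<sigma> @ [c])) \<in> Y_star act sim lam h"
      if "Inl (h \<sigma>) \<in> Y_star act sim lam h" "lam \<sigma> \<noteq> 1" "0 < step_prob act safe_strategy \<beta> \<sigma> c" for \<sigma> c
      using that by (rule safe_strategy_invariant)
    show "miss act lam safe_strategy \<beta> k \<sigma> \<le> d" if "Inl (h \<sigma>) \<in> Y_star act sim lam h" for \<sigma>
      using that by (rule miss)
  qed (fact d \<tau>')+
qed

section \<open>Histories consistent with a player strategy\<close>

text \<open>Every history of the information set may be a start, since a winning strategy must win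
  from each. Only the player's action needs positive probability; the move is left to an arbitrary
  environment.\<close>

inductive consistent :: "('c list \<Rightarrow> 'a pmf) \<Rightarrow> 'c list \<Rightarrow> 'c list \<Rightarrow> bool" for \<alpha> \<tau> where
  start: "(\<tau>, \<sigma>) \<in> sim \<Longrightarrow> consistent \<alpha> \<tau> \<sigma>"
| snoc: "consistent \<alpha> \<tau> \<sigma> \<Longrightarrow> pmf (\<alpha> \<sigma>) (act c) > 0 \<Longrightarrow> consistent \<alpha> \<tau> (\<sigma> @ [c])"

text \<open>Removing the last moves preserves indistinguishability, and these moves carry the same
  action; as \<open>\<alpha>\<close> agrees on the shortened histories, consistency is rebuilt move
  by move.\<close>

lemma consistent_sim:
  assumes "consistent \<alpha> \<tau> \<sigma>" "(\<sigma>, \<sigma>') \<in> sim" and \<alpha>: "player_strategy sim \<alpha>"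
  shows "consistent \<alpha> \<tau> \<sigma>'"
  using assms(1,2)
proof (induction arbitrary: \<sigma>')
  case (start \<sigma>)
  then show ?case by (blast intro: consistent.start sim_trans)
next
  case (snoc \<sigma> c)
  obtain \<rho> c' where \<sigma>': "\<sigma>' = \<rho> @ [c']"
    using sim_length[OF snoc.prems] by (cases \<sigma>' rule: rev_cases) auto
  then have "(\<sigma>, \<rho>) \<in> sim" "act c = act c'" using sim_snocD snoc.prems by blast+
  moreover have "\<alpha> \<rho> = \<alpha> \<sigma>" using \<alpha> \<open>(\<sigma>, \<rho>) \<in> sim\<close> by (simp add: player_strategy_def)
  ultimately show ?case unfolding \<sigma>' using snoc by (intro consistent.snoc) auto
qed

lemma consistent_start:
  assumes "consistent \<alpha> \<tau> \<sigma>"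
  shows "\<exists>\<tau>'. (\<tau>, \<tau>') \<in> sim \<and> prefix \<tau>' \<sigma> \<and>
    (\<forall>i\<in>{length \<tau>'..<length \<sigma>}. pmf (\<alpha> (take i \<sigma>)) (act (\<sigma> ! i)) > 0)"
  using assms
proof induction
  case (start \<sigma>)
  then show ?case by (intro exI[of _ \<sigma>]) auto
next
  case (snoc \<sigma> c)
  then obtain \<tau>' where "(\<tau>, \<tau>') \<in> sim" "prefix \<tau>' \<sigma>"
    "\<forall>i\<in>{length \<tau>'..<length \<sigma>}. pmf (\<alpha> (take i \<sigma>)) (act (\<sigma> ! i)) > 0"
    by blast
  then show ?case using snoc.hyps(2)
    by (intro exI[of _ \<tau>']) (auto simp: nth_append less_Suc_eq)
qed

text \<open>
  The environment steers the play to \<open>\<sigma>\<close>, which it does with positive probability, and from there on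
  answers every action by a move that stays in \<open>B\<close>.
\<close>

lemma not_winning_if_avoidable:
  assumes \<sigma>: "consistent \<alpha> \<tau> \<sigma>" "B \<sigma>"
    and avoid: "\<And>\<rho> a. consistent \<alpha> \<tau> \<rho> \<Longrightarrow> B \<rho> \<Longrightarrow> pmf (\<alpha> \<rho>) a > 0 \<Longrightarrow> \<exists>c. act c = a \<and> B (\<rho> @ [c])"
    and not_final: "\<And>\<rho>. B \<rho> \<Longrightarrow> lam \<rho> \<noteq> 1"
  shows "\<not> almost_sure_winning act sim lam Reach \<alpha> \<tau>"
proof
  assume win: "almost_sure_winning act sim lam Reach \<alpha> \<tau>"
  obtain \<tau>' where \<tau>': "(\<tau>, \<tau>') \<in> sim" "prefix \<tau>' \<sigma>"
    and pos: "\<And>i. i \<in> {length \<tau>'..<length \<sigma>} \<Longrightarrow> pmf (\<alpha> (take i \<sigma>)) (act (\<sigma> ! i)) > 0"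
    using consistent_start[OF \<sigma>(1)] by blast
  \<comment> \<open>A deterministic environment: the first case follows \<open>\<sigma>\<close> when
    the player's action permits; the last is a default that keeps \<open>\<beta>\<close> legal where
    no answer stays in \<open>B\<close>.\<close>
  define move where "move \<rho> a =
    (if strict_prefix \<rho> \<sigma> \<and> act (\<sigma> ! length \<rho>) = a then \<sigma> ! length \<rho>
     else if \<exists>c. act c = a \<and> B (\<rho> @ [c]) then SOME c. act c = a \<and> B (\<rho> @ [c])
     else inv act a)" for \<rho> a
  define \<beta> where "\<beta> \<rho> a = return_pmf (move \<rho> a)" for \<rho> a
  have B_move: "B (\<rho> @ [move \<rho> a])"
    if "prefix \<sigma> \<rho>" "\<exists>c. act c = a \<and> B (\<rho> @ [c])" for \<rho> a
  proof -
    have "\<not> strict_prefix \<rho> \<sigma>" using that(1) by (auto simp: strict_prefix_def)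
    then show ?thesis using that(2) someI_ex[OF that(2)] by (simp add: move_def)
  qed
  have "act (move \<rho> a) = a" for \<rho> a
  proof -
    have "act (SOME c. act c = a \<and> B (\<rho> @ [c])) = a" if "\<exists>c. act c = a \<and> B (\<rho> @ [c])"
      using someI_ex[OF that] by blast
    then show ?thesis by (auto simp: move_def surj_f_inv_f[OF surj_act])
  qed
  then have env: "environment_strategy act \<beta>"
    by (auto simp: environment_strategy_def \<beta>_def indicator_def split: if_splits)
  define M where "M = play_measure act \<alpha> \<beta> \<tau>'"
  have pm: "is_play_measure act \<alpha> \<beta> \<tau>' M"
    unfolding M_def by (rule is_play_measure_play_measure[OF env])
  interpret prob_space M using pm by (simp add: is_play_measure_def)
  have sets: "sets M = sets (stream_space (count_space UNIV))"
    using pm by (simp add: is_play_measure_def)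
  have cyl_sets: "sstart UNIV \<rho> \<in> sets M" for \<rho> unfolding sets by (rule sstart_sets)
  have cyl: "prob (sstart UNIV \<rho>) = cylinder_prob act \<alpha> \<beta> \<tau>' \<rho>" for \<rho>
    using pm by (simp add: is_play_measure_def)
  have "cylinder_prob act \<alpha> \<beta> \<tau>' \<sigma> > 0"
    unfolding cylinder_prob_extend[OF \<tau>'(2)]
  proof (rule prod_pos)
    fix i assume i: "i \<in> {length \<tau>'..<length \<sigma>}"
    then have "strict_prefix (take i \<sigma>) \<sigma>"
      by (auto simp: strict_prefix_def take_is_prefix dest: arg_cong[of _ _ length])
    then have "move (take i \<sigma>) (act (\<sigma> ! i)) = \<sigma> ! i"
      using i by (simp add: move_def min_def)
    then show "0 < pmf (\<alpha> (take i \<sigma>)) (act (\<sigma> ! i)) * pmf (\<beta> (take i \<sigma>) (act (\<sigma> ! i))) (\<sigma> ! i)"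
      using pos[OF i] by (simp add: \<beta>_def)
  qed
  then have pos_\<sigma>: "prob (sstart UNIV \<sigma>) > 0" by (simp add: cyl)
  \<comment> \<open>From \<open>\<sigma>\<close> on, a history of nonzero probability uses only
    actions that \<open>\<alpha>\<close> plays, answered by \<open>move\<close>, so it remains
    consistent and in \<open>B\<close>.\<close>
  have reachable: "consistent \<alpha> \<tau> \<rho> \<and> B \<rho>"
    if "prefix \<sigma> \<rho>" "cylinder_prob act \<alpha> \<beta> \<tau>' \<rho> \<noteq> 0" for \<rho>
    using that
  proof (induction \<rho> rule: rev_induct)
    case Nil
    then show ?case using \<sigma> by simp
  next
    case (snoc c \<rho>)
    show ?case
    proof (cases "prefix \<sigma> \<rho>")
      case True
      with \<tau>'(2) have "prefix \<tau>' \<rho>" by (rule prefix_order.trans)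
      with snoc.prems(2) have nz: "cylinder_prob act \<alpha> \<beta> \<tau>' \<rho> \<noteq> 0" "step_prob act \<alpha> \<beta> \<rho> c \<noteq> 0"
        by (auto simp: cylinder_prob_snoc)
      have IH: "consistent \<alpha> \<tau> \<rho>" "B \<rho>" using snoc.IH[OF True nz(1)] by auto
      have a: "pmf (\<alpha> \<rho>) (act c) > 0" and c: "c = move \<rho> (act c)"
        using nz(2) by (auto simp: step_prob_def \<beta>_def indicator_def less_le split: if_splits)
      have "B (\<rho> @ [c])" using B_move[OF True avoid[OF IH a]] c by simp
      then show ?thesis using consistent.snoc[OF IH(1) a] by simp
    next
      case False
      then have "\<rho> @ [c] = \<sigma>" using snoc.prems(1) by simp
      then show ?thesis using \<sigma> by simp
    qed
  qed
  \<comment> \<open>Countably many cylinders, each of probability 0, because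
    \<open>reachable\<close> and \<open>not_final\<close> exclude histories colored 1 that extend
    \<open>\<sigma>\<close>.\<close>
  define N where "N = (\<Union>\<rho>\<in>{\<rho>. prefix \<sigma> \<rho> \<and> lam \<rho> = 1}. sstart UNIV \<rho>)"
  have "N \<in> null_sets M"
    unfolding N_def
  proof (rule null_sets_UN')
    fix \<rho> assume "\<rho> \<in> {\<rho>. prefix \<sigma> \<rho> \<and> lam \<rho> = 1}"
    then have "cylinder_prob act \<alpha> \<beta> \<tau>' \<rho> = 0" using reachable not_final by auto
    then have "emeasure M (sstart UNIV \<rho>) = 0" using cyl by (simp add: emeasure_eq_measure)
    then show "sstart UNIV \<rho> \<in> null_sets M" using cyl_sets by (auto intro: null_setsI)
  qed auto
  then have "AE \<pi> in M. \<pi> \<notin> N" by (rule AE_not_in)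
  moreover have "AE \<pi> in M. \<pi> \<in> {\<pi>. color_sequence lam \<pi> \<in> Reach}"
  proof (rule AE_prob_1)
    show "prob {\<pi>. color_sequence lam \<pi> \<in> Reach} = 1"
      using win \<tau>'(1) env by (auto simp: almost_sure_winning_def M_def)
  qed
  ultimately have "AE \<pi> in M. \<pi> \<notin> sstart UNIV \<sigma>"
  proof eventually_elim
    case (elim \<pi>)
    then obtain n where n: "lam (stake n \<pi>) = 1" using in_Reach_iff by blast
    \<comment> \<open>At this length the prefix of \<open>\<pi>\<close> is colored 1 by absorption
      and extends \<open>\<sigma>\<close> whenever \<open>\<pi>\<close> does.\<close>
    let ?m = "max n (length \<sigma>)"
    have "lam (stake ?m \<pi>) = 1" using n by (rule absorbing_stake) simp
    moreover have "\<pi> \<in> sstart UNIV (stake ?m \<pi>)" by (simp add: in_sstart_iff_stake)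
    ultimately have "\<not> prefix \<sigma> (stake ?m \<pi>)" using elim(1) unfolding N_def by blast
    moreover have "prefix (stake (length \<sigma>) \<pi>) (stake ?m \<pi>)"
    proof -
      have "stake ?m \<pi> = stake (length \<sigma>) \<pi> @ stake (?m - length \<sigma>) (sdrop (length \<sigma>) \<pi>)"
        unfolding stake_add by simp
      then show ?thesis by (rule prefixI)
    qed
    ultimately show ?case unfolding in_sstart_iff_stake by (intro notI) simp
  qed
  then have "sstart UNIV \<sigma> \<in> null_sets M" using cyl_sets by (simp add: AE_iff_null_sets)
  then have "prob (sstart UNIV \<sigma>) = 0" by (simp add: null_sets_def measure_def)
  then show False using pos_\<sigma> by simp
qed

section \<open>Consistent histories of winning strategies as a post-fixpoint\<close>

lemma winning_Y_star:
  assumes "has_almost_sure_winning_strategy act sim lam Reach \<tau>"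
  shows "Inl (h \<tau>) \<in> Y_star act sim lam h"
proof -
  \<comment> \<open>All winning strategies and starts contribute to \<open>W\<close>; here
    \<open>\<tau>\<close> is bound and need not be the history of the lemma.\<close>
  define good where "good \<alpha> \<tau> \<sigma> \<longleftrightarrow> player_strategy sim \<alpha> \<and>
    almost_sure_winning act sim lam Reach \<alpha> \<tau> \<and> consistent \<alpha> \<tau> \<sigma>" for \<alpha> \<tau> \<sigma>
  define W :: "('p + 'p \<times> 'a) set" where "W = {Inl (h \<sigma>) | \<alpha> \<tau> \<sigma>. good \<alpha> \<tau> \<sigma>} \<union>
    {Inr (h \<sigma>, a) | \<alpha> \<tau> \<sigma> a. good \<alpha> \<tau> \<sigma> \<and> pmf (\<alpha> \<sigma>) a > 0}"
  define X where "X = lfp (\<lambda>X. int_approx sim h W \<inter> (Pre act h X \<union> Inl ` abs_final lam h))"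
  have good_sim: "good \<alpha> \<tau> \<sigma>'" "\<alpha> \<sigma>' = \<alpha> \<sigma>" if "good \<alpha> \<tau> \<sigma>" "(\<sigma>, \<sigma>') \<in> sim" for \<alpha> \<tau> \<sigma> \<sigma>'
    using that consistent_sim by (auto simp: good_def player_strategy_def)
  \<comment> \<open>An equivalent abstract state lifts to a history indistinguishable from
    \<open>\<sigma>\<close>, which is consistent with the same strategy and has the same actions
    played.\<close>
  have W_equiv: "y' \<in> W" if "y \<in> W" and y': "(y, y') \<in> abs_equiv_ext sim h" for y y'
  proof -
    from \<open>y \<in> W\<close> consider \<alpha> \<tau> \<sigma> where "y = Inl (h \<sigma>)" "good \<alpha> \<tau> \<sigma>"
      | \<alpha> \<tau> \<sigma> a where "y = Inr (h \<sigma>, a)" "good \<alpha> \<tau> \<sigma>" "pmf (\<alpha> \<sigma>) a > 0"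
      unfolding W_def by blast
    then show ?thesis
    proof cases
      case 1
      then obtain p' where "y' = Inl p'" "(h \<sigma>, p') \<in> abs_equiv sim h"
        using y' by (auto simp: abs_equiv_ext_def)
      then obtain \<sigma>' where "(\<sigma>, \<sigma>') \<in> sim" "y' = Inl (h \<sigma>')" by (auto elim: abs_equiv_lift)
      then show ?thesis using good_sim(1)[OF 1(2)] unfolding W_def by blast
    next
      case 2
      then obtain p' where "y' = Inr (p', a)" "(h \<sigma>, p') \<in> abs_equiv sim h"
        using y' by (auto simp: abs_equiv_ext_def)
      then obtain \<sigma>' where "(\<sigma>, \<sigma>') \<in> sim" "y' = Inr (h \<sigma>', a)" by (auto elim: abs_equiv_lift)
      moreover from this have "good \<alpha> \<tau> \<sigma>'" "pmf (\<alpha> \<sigma>') a > 0" using good_sim[OF 2(2)] 2(3) by auto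
      ultimately show ?thesis unfolding W_def by blast
    qed
  qed
  have X_eq: "X = int_approx sim h W \<inter> (Pre act h X \<union> Inl ` abs_final lam h)"
    unfolding X_def by (rule lfp_unfold[OF mono_inner])
  \<comment> \<open>\<open>W\<close> is a union of classes, so its elements lie in the interior of
    \<open>W\<close>; one missing from \<open>X\<close> must therefore fail both \<open>Pre\<close>
    and the target.\<close>
  have not_X: "y \<notin> Pre act h X" "y \<notin> Inl ` abs_final lam h" if "y \<in> W" "y \<notin> X" for y
  proof -
    have "y \<in> int_approx sim h W" using W_equiv[OF that(1)] unfolding int_approx_def by blast
    then show "y \<notin> Pre act h X" "y \<notin> Inl ` abs_final lam h" using that(2) X_eq by blast+
  qed
  have action_X: "Inr (h \<rho>, a) \<in> X"
    if "good \<alpha> \<tau> \<rho>" "pmf (\<alpha> \<rho>) a > 0" "\<And>c. act c = a \<Longrightarrow> Inl (h (\<rho> @ [c])) \<in> X" for \<alpha> \<tau> \<rho> a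
  proof (rule ccontr)
    assume "Inr (h \<rho>, a) \<notin> X"
    moreover have "Inr (h \<rho>, a) \<in> W" using that unfolding W_def by blast
    ultimately have "Inr (h \<rho>, a) \<notin> Pre act h X" by (intro not_X(1))
    then show False using that(3) by (auto simp: Pre_def step_h)
  qed
  have state_X: "Inl (h \<sigma>) \<in> X" if good: "good \<alpha> \<tau> \<sigma>" for \<alpha> \<tau> \<sigma>
  proof (rule ccontr)
    assume nX: "Inl (h \<sigma>) \<notin> X"
    \<comment> \<open>A consistent history outside \<open>X\<close> is not colored 1, and each
      action played there has a move to a history again outside \<open>X\<close>, as
      \<open>not_winning_if_avoidable\<close> demands.\<close>
    let ?B = "\<lambda>\<rho>. consistent \<alpha> \<tau> \<rho> \<and> Inl (h \<rho>) \<notin> X"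
    have W: "good \<alpha> \<tau> \<rho>" "Inl (h \<rho>) \<in> W" if "?B \<rho>" for \<rho>
      using that good unfolding good_def W_def by blast+
    have "\<not> almost_sure_winning act sim lam Reach \<alpha> \<tau>"
    proof (rule not_winning_if_avoidable[where B = ?B])
      show "?B \<sigma>" using good nX by (simp add: good_def)
      then show "consistent \<alpha> \<tau> \<sigma>" by simp
      fix \<rho>
      show "lam \<rho> \<noteq> 1" if "?B \<rho>"
        using not_X(2)[OF W(2)[OF that]] that abs_final_iff[of \<rho>] by blast
      fix a assume \<rho>: "consistent \<alpha> \<tau> \<rho>" "?B \<rho>" and a: "pmf (\<alpha> \<rho>) a > 0"
      have "Inr (h \<rho>, a) \<notin> X"
        using not_X(1)[OF W(2)[OF \<rho>(2)]] \<rho>(2) by (auto simp: Pre_def)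
      then obtain c where "act c = a" "Inl (h (\<rho> @ [c])) \<notin> X"
        using action_X[OF W(1)[OF \<rho>(2)] a] by blast
      then show "\<exists>c. act c = a \<and> ?B (\<rho> @ [c])" using consistent.snoc[OF \<rho>(1)] a by blast
    qed
    then show False using good by (simp add: good_def)
  qed
  have "W \<subseteq> X"
  proof
    fix y assume "y \<in> W"
    then consider \<alpha> \<tau> \<sigma> where "y = Inl (h \<sigma>)" "good \<alpha> \<tau> \<sigma>"
      | \<alpha> \<tau> \<sigma> a where "y = Inr (h \<sigma>, a)" "good \<alpha> \<tau> \<sigma>" "pmf (\<alpha> \<sigma>) a > 0"
      unfolding W_def by blast
    then show "y \<in> X"
    proof cases
      case 1
      then show ?thesis using state_X by simp
    next
      case 2
      have "Inl (h (\<sigma> @ [c])) \<in> X" if "act c = a" for c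
      proof (rule state_X)
        show "good \<alpha> \<tau> (\<sigma> @ [c])" using 2 that consistent.snoc by (simp add: good_def)
      qed
      then show ?thesis using action_X 2 by blast
    qed
  qed
  then have "W \<subseteq> Y_star act sim lam h"
    unfolding Y_star_def X_def by (rule gfp_upperbound)
  moreover have "Inl (h \<tau>) \<in> W"
  proof -
    obtain \<alpha> where "good \<alpha> \<tau> \<tau>"
      using assms consistent.start[OF sim_refl] unfolding good_def has_almost_sure_winning_strategy_def by blast
    then show ?thesis unfolding W_def by blast
  qed
  ultimately show ?thesis by blast
qed

text \<open>The right side depends on \<open>\<tau>\<close> only through \<open>h \<tau>\<close>, so
  either all histories with the same abstract state win or none does.\<close>

lemma winning_iff_Y_star:
  "has_almost_sure_winning_strategy act sim lam Reach \<tau> \<longleftrightarrow> Inl (h \<tau>) \<in> Y_star act sim lam h"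
  by (rule iffI[OF winning_Y_star Y_star_winning])

end

theorem theorem2:
  fixes act :: "'c::finite \<Rightarrow> 'a::finite"
    and sim :: "('c list \<times> 'c list) set"
    and lam :: "'c list \<Rightarrow> nat"
    and h :: "'c list \<Rightarrow> 'p::finite"
  assumes "imperfect_information_game act sim {0, 1} lam"
    and "\<And>\<tau> c. lam \<tau> = 1 \<Longrightarrow> lam (\<tau> @ [c]) = 1"
    and "rectangular_morphism sim lam h"
  shows "Inl -` Y_star act sim lam h = universally_winning act sim lam h
    \<and> universally_winning act sim lam h = existentially_winning act sim lam h"
proof -
  interpret reachability_game act sim lam h by (rule reachability_game.intro[OF assms])
  let ?Y = "Inl -` Y_star act sim lam h"
  have "existentially_winning act sim lam h \<subseteq> ?Y"
    by (auto simp: existentially_winning_def winning_iff_Y_star)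
  moreover have "?Y \<subseteq> universally_winning act sim lam h"
    by (auto simp: universally_winning_def winning_iff_Y_star)
  moreover have "universally_winning act sim lam h \<subseteq> existentially_winning act sim lam h"
  proof
    fix p assume "p \<in> universally_winning act sim lam h"
    \<comment> \<open>Surjectivity of \<open>h\<close> keeps the universal condition on
      \<open>p\<close> from being vacuous.\<close>
    moreover obtain \<tau> where "p = h \<tau>" using surj_h by (rule surjE)
    ultimately show "p \<in> existentially_winning act sim lam h"
      unfolding universally_winning_def existentially_winning_def by blast
  qed
  ultimately show ?thesis by blast
qed

end
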